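(* Let $G=(V,E)$ be an undirected weighted graph on $n$ vertices. Then for any $\rho>0$ and any $k\ge 1$, there exists a strong diameter $(8k\cdot n^{1/k},\,2k,\,\rho)$-sparse cover of $G$.
   Context: Graphs are undirected with non-negative edge weights, equipped with the shortest-path metric $d_G$; it is assumed that the minimal distance between distinct vertices of $G$ is $1$. For $v\in V$ and $\rho>0$, $B(v,\rho)=\{u\in V: d_G(u,v)\le\rho\}$ is the ball of radius $\rho$ around $v$. For $U\subseteq V$, $G[U]$ denotes the induced subgraph on $U$, and $\mathrm{diam}(G[U])$ its diameter with respect to its own shortest-path metric. For $\beta\ge 1$, $s\ge 1$, $\rho>0$, a collection of vertex subsets (clusters) $\mathcal{C}=\{C_1,\dots,C_t\}$ is a strong diameter $(\beta,s,\rho)$-sparse cover if: (i) $\mathrm{diam}(G[C_i])\le\beta\rho$ for all $i$; (ii) for each $v\in V$ there is $i$ with $B(v,\rho)\subseteq C_i$; (iii) each $v\in V$ is contained in at most $s$ clusters of $\mathcal{C}$. *)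

theory Defs
  imports
    Complex_Main
    "HOL-Library.Extended_Real"
    "Graph_Theory.Digraph_Component"
    "Graph_Theory.Shortest_Path"
begin

(* An undirected graph is a finite simple symmetric digraph (locale graph); an
   undirected edge is a pair of opposite arcs, which must carry the same weight.
   The shortest-path distance \<mu> w u v is extended-real-valued: it is \<infinity> between
   different components. The normalisation of the minimal distance therefore
   concerns the pairs at finite distance, and is void if there are none (for
   example, if there is only one vertex). *)
locale weighted_graph = graph G
  for G :: "('v, 'e) pre_digraph" (structure) +
  fixes w :: "'e weight_fun"
  assumes weight_nonneg: "e \<in> arcs G \<Longrightarrow> 0 \<le> w e"
    and weight_sym: "\<lbrakk>e \<in> arcs G; e' \<in> arcs G; tail G e = head G e'; head G e = tail G e'\<rbrakk>
      \<Longrightarrow> w e = w e'"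
    and min_dist_one:
      "{\<mu> w u v | u v. u \<in> verts G \<and> v \<in> verts G \<and> u \<noteq> v \<and> \<mu> w u v < \<infinity>} \<noteq> {} \<Longrightarrow>
       Min {\<mu> w u v | u v. u \<in> verts G \<and> v \<in> verts G \<and> u \<noteq> v \<and> \<mu> w u v < \<infinity>} = 1"

definition graph_ball ::
  "('v, 'e) pre_digraph \<Rightarrow> 'e weight_fun \<Rightarrow> 'v \<Rightarrow> real \<Rightarrow> 'v set" where
  "graph_ball G w v \<rho> = {u \<in> verts G. wf_digraph.\<mu> G w u v \<le> ereal \<rho>}"

definition graph_diam :: "('v, 'e) pre_digraph \<Rightarrow> 'e weight_fun \<Rightarrow> ereal" where
  "graph_diam G w = (SUP u\<in>verts G. SUP v\<in>verts G. wf_digraph.\<mu> G w u v)"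

(* G \<restriction> C is the induced subgraph; its vertex set is C only if C consists of
   vertices of G, hence the first conjunct. *)
definition strong_sparse_cover ::
  "('v, 'e) pre_digraph \<Rightarrow> 'e weight_fun \<Rightarrow> real \<Rightarrow> real \<Rightarrow> real \<Rightarrow> 'v set set \<Rightarrow> bool" where
  "strong_sparse_cover G w \<beta> s \<rho> \<C> \<longleftrightarrow>
     (\<forall>C\<in>\<C>. C \<subseteq> verts G) \<and>
     (\<forall>C\<in>\<C>. graph_diam (G \<restriction> C) w \<le> ereal (\<beta> * \<rho>)) \<and>
     (\<forall>v\<in>verts G. \<exists>C\<in>\<C>. graph_ball G w v \<rho> \<subseteq> C) \<and>
     (\<forall>v\<in>verts G. real (card {C \<in> \<C>. v \<in> C}) \<le> s)"

end

theory Submission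
  imports Defs
begin

text \<open>Balls are carved off one after the other from the graph induced on the remaining vertices:
  the cluster is a ball of radius \<open>r + 2\<rho>\<close>, but only its core of radius \<open>r\<close> is removed. A
  \<open>\<rho>\<close>-ball meeting the core lies in the cluster, and all others stay intact. To bound the overlap,
  the weight of a vertex is multiplied by \<open>W\<close> whenever it lies in a cluster outside the core.
  Region growing in steps of \<open>2\<rho>\<close> finds within about \<open>W ln n\<close> steps a radius for which the total
  weight, initially \<open>n\<close>, decreases. With \<open>m = \<lfloor>2k\<rfloor>\<close> and \<open>W = n powr (1 / m)\<close>, each vertex is then in
  at most \<open>m\<close> clusters. As \<open>1 / m\<close> is roughly \<open>1 / (2k)\<close>, there is room to absorb the factor \<open>ln n\<close>
  into \<open>k n powr (1 / k)\<close>.\<close>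

section \<open>Balls in symmetric weighted graphs\<close>

text \<open>The carving works in subgraphs induced on the remaining vertices, whose minimal distance
  may exceed 1. The properties collected here pass to such subgraphs.\<close>

locale symmetric_weighted_graph = pseudo_graph G
  for G :: "('v, 'e) pre_digraph" (structure) +
  fixes w :: "'e weight_fun"
  assumes nonneg: "e \<in> arcs G \<Longrightarrow> 0 \<le> w e"
    and sym_weight: "\<lbrakk>e \<in> arcs G; e' \<in> arcs G; tail G e = head G e'; head G e = tail G e'\<rbrakk>
      \<Longrightarrow> w e = w e'"
begin

lemma induce: "S \<subseteq> verts G \<Longrightarrow> symmetric_weighted_graph (G \<restriction> S) w"
proof -
  assume S: "S \<subseteq> verts G"
  have "symmetric (G \<restriction> S)"
    using sym_arcs induced_graph_imp_symmetric induced_induce[OF S] by blast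
  then show ?thesis
    using S finite_subset[OF S finite_verts]
    by unfold_locales (auto intro: nonneg sym_weight)
qed

text \<open>As weights are non-negative, a finite \<open>\<mu>\<close> is attained by a cheapest
  path. Distance estimates thereby reduce to appending, reversing and restricting walks.\<close>

lemma mu_le_iff: "\<mu> w u v \<le> ereal r \<longleftrightarrow> (\<exists>p. awalk u p v \<and> awalk_cost w p \<le> r)"
proof
  assume le: "\<mu> w u v \<le> ereal r"
  then have "\<mu> w u v < \<infinity>" using le_less_trans[OF le, of \<infinity>] by simp
  then have "u \<rightarrow>\<^sup>* v" by (simp only: \<mu>_reach_conv)
  then obtain p where "apath u p v" "\<mu> w u v = ereal (awalk_cost w p)"
    using min_cost_awalk[of u v w] nonneg by blast
  then show "\<exists>p. awalk u p v \<and> awalk_cost w p \<le> r"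
    using le awalkI_apath by auto
next
  assume "\<exists>p. awalk u p v \<and> awalk_cost w p \<le> r"
  then obtain p where p: "awalk u p v" "awalk_cost w p \<le> r" by blast
  then have "ereal (awalk_cost w p) \<le> ereal r" by simp
  with min_cost_le_walk_cost[OF p(1)] show "\<mu> w u v \<le> ereal r" by (rule order_trans)
qed

lemma mu_trans_le:
  assumes "\<mu> w u v \<le> ereal r" "\<mu> w v x \<le> ereal s"
  shows "\<mu> w u x \<le> ereal (r + s)"
proof -
  obtain p q where "awalk u p v" "awalk_cost w p \<le> r" "awalk v q x" "awalk_cost w q \<le> s"
    using assms unfolding mu_le_iff by blast
  then have "awalk u (p @ q) x" "awalk_cost w (p @ q) \<le> r + s"
    using awalk_appendI by (blast, simp)
  then show ?thesis unfolding mu_le_iff by blast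
qed

lemma reverse_awalk: "awalk u p v \<Longrightarrow> \<exists>q. awalk v q u \<and> awalk_cost w q = awalk_cost w p"
proof (induction p arbitrary: u)
  case Nil
  then show ?case by (auto simp: awalk_Nil_iff intro!: exI[of _ "[]"])
next
  case (Cons e p)
  then have e: "e \<in> arcs G" "tail G e = u" and p: "awalk (head G e) p v"
    by (auto simp: awalk_Cons_iff)
  obtain q where q: "awalk v q (head G e)" "awalk_cost w q = awalk_cost w p"
    using Cons.IH[OF p] by blast
  obtain e' where e': "e' \<in> arcs G" "tail G e = head G e'" "head G e = tail G e'"
    using sym_arcs e(1) by (auto simp: symmetric_conv)
  have "awalk (head G e) [e'] u"
    using e e' tail_in_verts[OF e(1)] by (simp add: awalk_Cons_iff awalk_Nil_iff)
  moreover have "w e = w e'" using sym_weight e e' by blast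
  ultimately show ?case
    using awalk_appendI[OF q(1)] q(2) by (intro exI[of _ "q @ [e']"]) simp
qed

lemma mu_sym_le: "\<mu> w u v \<le> ereal r \<Longrightarrow> \<mu> w v u \<le> ereal r"
  by (metis mu_le_iff reverse_awalk)

lemma mu_self_le: "u \<in> verts G \<Longrightarrow> 0 \<le> r \<Longrightarrow> \<mu> w u u \<le> ereal r"
  by (auto simp: mu_le_iff awalk_Nil_iff intro!: exI[of _ "[]"])

lemma mem_graph_ball: "u \<in> graph_ball G w v r \<longleftrightarrow> u \<in> verts G \<and> \<mu> w u v \<le> ereal r"
  by (simp add: graph_ball_def)

lemma graph_ball_subset: "graph_ball G w v r \<subseteq> verts G"
  by (auto simp: mem_graph_ball)

lemma graph_ball_mono: "r \<le> s \<Longrightarrow> graph_ball G w v r \<subseteq> graph_ball G w v s"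
  unfolding graph_ball_def using order_trans[of _ "ereal r" "ereal s"] by auto

text \<open>No weight is negative, so the rest of the walk from any of its vertices costs at most as
  much as the whole.\<close>

lemma awalk_verts_in_graph_ball:
  "awalk u p v \<Longrightarrow> awalk_cost w p \<le> r \<Longrightarrow> set (awalk_verts u p) \<subseteq> graph_ball G w v r"
proof (induction p arbitrary: u)
  case Nil
  then show ?case
    by (auto simp: mem_graph_ball awalk_Nil_iff intro: mu_self_le)
next
  case (Cons e p)
  have e: "e \<in> arcs G" and p: "awalk (head G e) p v"
    using Cons.prems by (auto simp: awalk_Cons_iff)
  have "awalk_cost w p \<le> r" using Cons.prems nonneg[OF e] by simp
  moreover have "u \<in> graph_ball G w v r"
    using Cons.prems by (auto simp: mem_graph_ball mu_le_iff)
  ultimately show ?case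
    using Cons.IH[OF p] Cons.prems by (auto simp: awalk_Cons_iff)
qed

text \<open>A walk of cost at most \<open>r\<close> ending in \<open>v\<close> stays inside the ball around \<open>v\<close>.\<close>

lemma mu_induce_le:
  assumes le: "\<mu> w u v \<le> ereal r" and ball: "graph_ball G w v r \<subseteq> S" and S: "S \<subseteq> verts G"
  shows "wf_digraph.\<mu> (G \<restriction> S) w u v \<le> ereal r"
proof -
  interpret I: symmetric_weighted_graph "G \<restriction> S" w using induce[OF S] .
  obtain p where p: "awalk u p v" "awalk_cost w p \<le> r"
    using le by (auto simp: mu_le_iff)
  have vs: "set (awalk_verts u p) \<subseteq> S"
    using awalk_verts_in_graph_ball[OF p] ball by blast
  then have "set p \<subseteq> arcs (G \<restriction> S)"
    using p(1) by (auto simp: set_awalk_verts)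
  then have "I.awalk u p v"
    using p(1) vs hd_in_awalk_verts(1)[OF p(1)]
    by (auto simp: pre_digraph.awalk_def compatible_cas[OF compatible_induce_subgraph])
  then show ?thesis
    using p(2) by (auto simp: I.mu_le_iff)
qed

text \<open>Cheap walks to the centre do not leave the ball, so two vertices can be joined through
  \<open>v\<close> inside it.\<close>

lemma graph_diam_ball:
  "graph_diam (G \<restriction> graph_ball G w v r) w \<le> ereal (2 * r)"
proof -
  let ?B = "graph_ball G w v r"
  interpret I: symmetric_weighted_graph "G \<restriction> ?B" w using induce[OF graph_ball_subset] .
  have *: "I.\<mu> w u v \<le> ereal r" if "u \<in> ?B" for u
    using that mu_induce_le[OF _ _ graph_ball_subset] by (simp add: mem_graph_ball)
  have "I.\<mu> w x y \<le> ereal (2 * r)" if "x \<in> ?B" "y \<in> ?B" for x y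
    using I.mu_trans_le[OF *[OF that(1)] I.mu_sym_le[OF *[OF that(2)]]] by simp
  then show ?thesis by (auto simp: graph_diam_def intro!: SUP_least)
qed

text \<open>As the small ball lies within \<open>S\<close>, its vertices stay within
  \<open>\<rho>\<close> of \<open>u\<close> in \<open>G \<restriction> S\<close>. If one of them is
  within \<open>r\<close> of \<open>v\<close>, the others reach \<open>v\<close> via
  \<open>u\<close> at cost at most \<open>\<rho> + (\<rho> + r)\<close>.\<close>

lemma graph_ball_swallowed_or_avoided:
  assumes S: "S \<subseteq> verts G" and ball: "graph_ball G w u \<rho> \<subseteq> S"
  shows "graph_ball G w u \<rho> \<subseteq> graph_ball (G \<restriction> S) w v (r + 2 * \<rho>) \<or>
    graph_ball G w u \<rho> \<inter> graph_ball (G \<restriction> S) w v r = {}"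
proof (rule disjCI)
  interpret I: symmetric_weighted_graph "G \<restriction> S" w using induce[OF S] .
  have near: "I.\<mu> w x u \<le> ereal \<rho>" if "x \<in> graph_ball G w u \<rho>" for x
    using that mu_induce_le[OF _ ball S] by (simp add: mem_graph_ball)
  assume "graph_ball G w u \<rho> \<inter> graph_ball (G \<restriction> S) w v r \<noteq> {}"
  then obtain y where y: "y \<in> graph_ball G w u \<rho>" "I.\<mu> w y v \<le> ereal r"
    by (auto simp: I.mem_graph_ball)
  have uv: "I.\<mu> w u v \<le> ereal (\<rho> + r)"
    using I.mu_trans_le[OF I.mu_sym_le[OF near[OF y(1)]] y(2)] .
  show "graph_ball G w u \<rho> \<subseteq> graph_ball (G \<restriction> S) w v (r + 2 * \<rho>)"
  proof
    fix x assume x: "x \<in> graph_ball G w u \<rho>"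
    have "I.\<mu> w x v \<le> ereal (\<rho> + (\<rho> + r))"
      using I.mu_trans_le[OF near[OF x] uv] .
    moreover have "\<rho> + (\<rho> + r) = r + 2 * \<rho>" by simp
    ultimately show "x \<in> graph_ball (G \<restriction> S) w v (r + 2 * \<rho>)"
      using x ball by (auto simp: I.mem_graph_ball)
  qed
qed

end

lemma (in weighted_graph) symmetric_weighted_graph: "symmetric_weighted_graph G w"
  by unfold_locales (auto intro: weight_nonneg weight_sym)

lemma induce_subgraph_induce_subgraph:
  "T \<subseteq> S \<Longrightarrow> (G \<restriction> S) \<restriction> T = G \<restriction> T"
  by (auto simp: induce_subgraph_def)

section \<open>Region growing\<close>

text \<open>If all \<open>L\<close> steps were fast, each would multiply \<open>a\<close> by at
  least \<open>1 + 1 / (W - 1)\<close>. The logarithm of this factor is at least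
  \<open>1 / W\<close>, so \<open>a L\<close> would exceed \<open>N\<close>.\<close>

lemma slow_growth_index:
  fixes a :: "nat \<Rightarrow> real" and W N :: real
  assumes W: "W \<ge> 1" and N: "N \<ge> 1" and a0: "a 0 \<ge> 1" and bound: "\<And>i. a i \<le> N"
    and mono: "\<And>i. a i \<le> a (Suc i)" and L: "real L > W * ln N"
  shows "\<exists>i<L. (W - 1) * (a (Suc i) - a i) < a i"
proof (rule ccontr)
  assume slow: "\<not> ?thesis"
  have fast: "a i \<le> (W - 1) * (a (Suc i) - a i)" if "i < L" for i
    using slow that linorder_not_less by blast
  have pos: "1 \<le> a i" for i
  proof (induction i)
    case (Suc i)
    then show ?case using mono[of i] by linarith
  qed (rule a0)
  have "0 \<le> W * ln N" using W N by simp
  then have Lpos: "0 < L" using L by linarith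
  \<comment> \<open>For \<open>W = 1\<close> a fast step would force \<open>a 0 \<le> 0\<close>.
    Excluding this permits division by \<open>W - 1\<close>.\<close>
  have W1: "W > 1"
    using fast[OF Lpos] pos[of 0] W by (cases "W = 1") auto
  have step: "a i * (1 + 1 / (W - 1)) \<le> a (Suc i)" if "i < L" for i
    using fast[OF that] W1 by (simp add: field_simps)
  have "(1 + 1 / (W - 1)) ^ i \<le> a i" if "i \<le> L" for i
    using that
  proof (induction i)
    case 0
    then show ?case using a0 by simp
  next
    case (Suc i)
    have "(1 + 1 / (W - 1)) ^ Suc i \<le> a i * (1 + 1 / (W - 1))"
      using Suc W1 mult_right_mono[of "(1 + 1 / (W - 1)) ^ i" "a i" "1 + 1 / (W - 1)"]
      by (simp add: mult.commute)
    then show ?case using step[of i] Suc.prems by simp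
  qed
  then have "(1 + 1 / (W - 1)) ^ L \<le> N" using bound[of L] by force
  moreover have pos': "0 < 1 + 1 / (W - 1)" using W1 by (simp add: add_pos_pos)
  ultimately have "ln ((1 + 1 / (W - 1)) ^ L) \<le> ln N"
    by (intro ln_mono) auto
  then have le: "real L * ln (1 + 1 / (W - 1)) \<le> ln N"
    using pos' by (simp only: ln_realpow)
  have "1 / W \<le> ln (1 + 1 / (W - 1))"
  proof -
    have "ln (1 - 1 / W) \<le> - (1 / W)"
      using ln_le_minus_one[of "1 - 1 / W"] W1 by simp
    moreover have "1 + 1 / (W - 1) = inverse (1 - 1 / W)"
      using W1 by (simp add: field_simps)
    ultimately show ?thesis using W1 by (simp add: ln_inverse)
  qed
  then have "real L * (1 / W) \<le> ln N"
    using le mult_left_mono[of "1 / W" "ln (1 + 1 / (W - 1))" "real L"] by linarith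
  then show False using L W1 by (simp add: field_simps)
qed

text \<open>Each vertex carries the weight \<open>W ^ c v\<close>, where \<open>c v\<close> counts the clusters so far that
  contain \<open>v\<close> without removing it. Carving out \<open>I\<close> with cluster \<open>C\<close> decreases the total weight
  below \<open>W ^ m\<close>, so no vertex is left over more than \<open>m - 1\<close> times.\<close>

lemma carving_cover:
  fixes W :: real and B :: "'v \<Rightarrow> 'v set" and P :: "'v set \<Rightarrow> bool"
  assumes W: "W \<ge> 1"
    and center: "\<And>v. v \<in> V \<Longrightarrow> v \<in> B v"
    and carve: "\<And>S c. \<lbrakk>S \<subseteq> V; S \<noteq> {}; (\<Sum>x\<in>S. W ^ c x) \<le> W ^ m\<rbrakk> \<Longrightarrow>
      \<exists>I C. I \<noteq> {} \<and> I \<subseteq> C \<and> C \<subseteq> S \<and> P C \<and>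
        (W - 1) * (\<Sum>x\<in>C - I. W ^ c x) < (\<Sum>x\<in>I. W ^ c x) \<and>
        (\<forall>u\<in>V. B u \<subseteq> S \<longrightarrow> B u \<subseteq> C \<or> B u \<inter> I = {})"
    and "finite V" "S \<subseteq> V" "(\<Sum>x\<in>S. W ^ c x) \<le> W ^ m" "\<And>x. x \<in> S \<Longrightarrow> c x < m"
  shows "\<exists>\<C>. finite \<C> \<and> (\<forall>C\<in>\<C>. C \<subseteq> S \<and> P C) \<and>
    (\<forall>u\<in>V. B u \<subseteq> S \<longrightarrow> (\<exists>C\<in>\<C>. B u \<subseteq> C)) \<and>
    (\<forall>x\<in>S. card {C \<in> \<C>. x \<in> C} + c x \<le> m)"
  using assms(4-7)
proof (induction "card S" arbitrary: S c rule: less_induct)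
  case less
  show ?case
  proof (cases "S = {}")
    case True
    \<comment> \<open>Since each \<open>u\<close> lies in \<open>B u\<close>, no \<open>B u\<close>
      fits into the empty set.\<close>
    then show ?thesis using center by (intro exI[of _ "{}"]) auto
  next
    case False
    from carve[OF less.prems(2) False less.prems(3)]
    obtain I C where I: "I \<noteq> {}" "I \<subseteq> C" and C: "C \<subseteq> S" "P C"
      and drop: "(W - 1) * (\<Sum>x\<in>C - I. W ^ c x) < (\<Sum>x\<in>I. W ^ c x)"
      and cov: "\<forall>u\<in>V. B u \<subseteq> S \<longrightarrow> B u \<subseteq> C \<or> B u \<inter> I = {}"
      by (elim exE conjE) (rule that; assumption)
    have finS: "finite S" using less.prems finite_subset by blast
    define S' c' where "S' = S - I" and "c' = (\<lambda>x. if x \<in> C then Suc (c x) else c x)"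
    have card: "card S' < card S"
      unfolding S'_def using I C finS by (intro psubset_card_mono) auto
    have S'V: "S' \<subseteq> V" using less.prems(2) by (auto simp: S'_def)
    have split: "(\<Sum>x\<in>S. W ^ c x) =
        (\<Sum>x\<in>S - C. W ^ c x) + (\<Sum>x\<in>C - I. W ^ c x) + (\<Sum>x\<in>I. W ^ c x)"
      using sum.subset_diff[OF C(1) finS, of "\<lambda>x. W ^ c x"]
        sum.subset_diff[OF I(2) finite_subset[OF C(1) finS], of "\<lambda>x. W ^ c x"] by simp
    have "S' = (S - C) \<union> (C - I)" using I C by (auto simp: S'_def)
    then have "(\<Sum>x\<in>S'. W ^ c' x) = (\<Sum>x\<in>S - C. W ^ c' x) + (\<Sum>x\<in>C - I. W ^ c' x)"
      using finS finite_subset[OF C(1) finS] by (simp only:) (rule sum.union_disjoint, auto)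
    also have "\<dots> = (\<Sum>x\<in>S - C. W ^ c x) + W * (\<Sum>x\<in>C - I. W ^ c x)"
      by (auto simp: c'_def sum_distrib_left intro!: arg_cong2[where f = "(+)"] sum.cong)
    \<comment> \<open>The factor \<open>W\<close> adds \<open>W - 1\<close> times the old weight of
      \<open>C - I\<close>, which by \<open>drop\<close> is less than the weight removed with
      \<open>I\<close>.\<close>
    also have "\<dots> < (\<Sum>x\<in>S. W ^ c x)"
      using drop split by (simp add: algebra_simps)
    finally have less': "(\<Sum>x\<in>S'. W ^ c' x) < W ^ m" using less.prems(3) by simp
    \<comment> \<open>A single vertex with \<open>c' x \<ge> m\<close> would already outweigh the
      total, which is strictly below \<open>W ^ m\<close>.\<close>
    have c'm: "c' x < m" if "x \<in> S'" for x
    proof (rule ccontr)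
      assume "\<not> c' x < m"
      then have "W ^ m \<le> W ^ c' x" using W by (intro power_increasing) auto
      also have "\<dots> \<le> (\<Sum>x\<in>S'. W ^ c' x)"
        using that W finS by (intro member_le_sum) (auto simp: S'_def)
      finally show False using less' by simp
    qed
    have "\<exists>\<C>. finite \<C> \<and> (\<forall>D\<in>\<C>. D \<subseteq> S' \<and> P D) \<and>
        (\<forall>u\<in>V. B u \<subseteq> S' \<longrightarrow> (\<exists>D\<in>\<C>. B u \<subseteq> D)) \<and>
        (\<forall>x\<in>S'. card {D \<in> \<C>. x \<in> D} + c' x \<le> m)"
      by (rule less.hyps[OF card less.prems(1) S'V less_imp_le[OF less']]) (rule c'm)
    then obtain \<C> where \<C>: "finite \<C>" "\<forall>D\<in>\<C>. D \<subseteq> S' \<and> P D"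
      "\<forall>u\<in>V. B u \<subseteq> S' \<longrightarrow> (\<exists>D\<in>\<C>. B u \<subseteq> D)"
      "\<forall>x\<in>S'. card {D \<in> \<C>. x \<in> D} + c' x \<le> m"
      by (elim exE conjE) (rule that; assumption)
    have "card {D \<in> insert C \<C>. x \<in> D} + c x \<le> m" if "x \<in> S" for x
    proof -
      have 1: "card {D \<in> insert C \<C>. x \<in> D} \<le>
          card {D \<in> \<C>. x \<in> D} + (if x \<in> C then 1 else 0)"
      proof (cases "x \<in> C")
        case True
        then have "{D \<in> insert C \<C>. x \<in> D} = insert C {D \<in> \<C>. x \<in> D}" by auto
        then show ?thesis using True \<C>(1) by (simp add: card_insert_if)
      next
        case False
        then have "{D \<in> insert C \<C>. x \<in> D} = {D \<in> \<C>. x \<in> D}" by auto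
        then show ?thesis by simp
      qed
      show ?thesis
      proof (cases "x \<in> I")
        \<comment> \<open>A core vertex lies in no later cluster, so \<open>C\<close> is its last
          one, and the strict \<open>c x < m\<close> leaves room for it. Outside the core,
          \<open>c'\<close> has already counted \<open>C\<close>.\<close>
        case True
        then have "{D \<in> \<C>. x \<in> D} = {}" using \<C>(2) by (auto simp: S'_def)
        then have "card {D \<in> \<C>. x \<in> D} = 0" by (simp only: card.empty)
        moreover have "(if x \<in> C then 1 else 0) \<le> (1 :: nat)" by simp
        ultimately show ?thesis using 1 less.prems(4)[OF that] by linarith
      next
        case False
        then have "card {D \<in> \<C>. x \<in> D} + c' x \<le> m" using \<C>(4) that by (simp add: S'_def)
        then show ?thesis using 1 by (auto simp: c'_def split: if_splits)
      qed
    qed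
    moreover have "\<exists>D\<in>insert C \<C>. B u \<subseteq> D" if "u \<in> V" "B u \<subseteq> S" for u
    proof (cases "B u \<subseteq> C")
      case False
      then have "B u \<subseteq> S'" using cov that by (auto simp: S'_def)
      then show ?thesis using \<C>(3) that by auto
    qed auto
    moreover have "D \<subseteq> S \<and> P D" if "D \<in> insert C \<C>" for D
      using that \<C>(2) C by (auto simp: S'_def)
    ultimately show ?thesis using \<C>(1) by (intro exI[of _ "insert C \<C>"]) auto
  qed
qed

section \<open>Carving balls out of a weighted graph\<close>

context symmetric_weighted_graph
begin

text \<open>A slow step \<open>i\<close> of the growing balls \<open>D\<close> gives the core
  \<open>D i\<close> and the cluster \<open>D (Suc i)\<close>. The bound \<open>f x \<ge> 1\<close>
  makes the first ball weigh at least 1.\<close>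

lemma carve_ball:
  fixes f :: "'v \<Rightarrow> real"
  assumes S: "S \<subseteq> verts G" "S \<noteq> {}" and f: "\<And>x. f x \<ge> 1" and sum: "sum f S \<le> N"
    and W: "W \<ge> 1" and L: "real L > W * ln N" and \<rho>: "\<rho> > 0"
  shows "\<exists>I C. I \<noteq> {} \<and> I \<subseteq> C \<and> C \<subseteq> S \<and> graph_diam (G \<restriction> C) w \<le> ereal (4 * real L * \<rho>) \<and>
    (W - 1) * sum f (C - I) < sum f I \<and>
    (\<forall>u\<in>verts G. graph_ball G w u \<rho> \<subseteq> S \<longrightarrow>
       graph_ball G w u \<rho> \<subseteq> C \<or> graph_ball G w u \<rho> \<inter> I = {})"
proof -
  interpret H: symmetric_weighted_graph "G \<restriction> S" w using induce[OF S(1)] .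
  obtain v where v: "v \<in> S" using S(2) by blast
  define D where "D i = graph_ball (G \<restriction> S) w v (real i * (2 * \<rho>))" for i
  have DS: "D i \<subseteq> S" for i using H.graph_ball_subset by (auto simp: D_def)
  have fin: "finite S" using S(1) finite_verts finite_subset by blast
  have finD: "finite (D i)" for i using DS fin finite_subset by blast
  have D_Suc: "D i \<subseteq> D (Suc i)" for i
    unfolding D_def using \<rho> by (intro H.graph_ball_mono) (simp add: algebra_simps)
  have vD: "v \<in> D i" for i
    unfolding D_def H.mem_graph_ball using v \<rho> H.mu_self_le by simp
  have f0: "0 \<le> f x" for x using f[of x] by simp
  have a0: "1 \<le> sum f (D i)" for i
    using member_le_sum[of v "D i" f] vD[of i] finD[of i] f0 f[of v] by force
  have aN: "sum f (D i) \<le> N" for i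
    using sum_mono2[OF fin DS, of i f] f0 sum by force
  have "1 \<le> N" using a0[of 0] aN[of 0] by simp
  moreover have "sum f (D i) \<le> sum f (D (Suc i))" for i
    by (rule sum_mono2[OF finD D_Suc f0])
  ultimately have "\<exists>i<L. (W - 1) * (sum f (D (Suc i)) - sum f (D i)) < sum f (D i)"
    using slow_growth_index[of W N "\<lambda>i. sum f (D i)" L] W a0 aN L by simp
  then obtain i where i: "i < L" "(W - 1) * (sum f (D (Suc i)) - sum f (D i)) < sum f (D i)"
    by blast
  \<comment> \<open>The radius is at most \<open>2 * L * \<rho>\<close>, and the diameter at most
    twice that.\<close>
  have "graph_diam (G \<restriction> D (Suc i)) w \<le> ereal (2 * (real (Suc i) * (2 * \<rho>)))"
    using H.graph_diam_ball[of v "real (Suc i) * (2 * \<rho>)"]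
    by (simp only: induce_subgraph_induce_subgraph[OF DS] flip: D_def)
  also have "\<dots> \<le> ereal (4 * real L * \<rho>)"
    using i(1) \<rho> by simp
  finally have diam: "graph_diam (G \<restriction> D (Suc i)) w \<le> ereal (4 * real L * \<rho>)" .
  have "real (Suc i) * (2 * \<rho>) = real i * (2 * \<rho>) + 2 * \<rho>" by (simp add: algebra_simps)
  then have cov: "graph_ball G w u \<rho> \<subseteq> D (Suc i) \<or> graph_ball G w u \<rho> \<inter> D i = {}"
    if "graph_ball G w u \<rho> \<subseteq> S" for u
    using graph_ball_swallowed_or_avoided[OF S(1) that, of v "real i * (2 * \<rho>)"]
    by (simp add: D_def)
  show ?thesis
  proof (rule exI[of _ "D i"], rule exI[of _ "D (Suc i)"], intro conjI)
    show "D i \<noteq> {}" using vD by blast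
    show "(W - 1) * sum f (D (Suc i) - D i) < sum f (D i)"
      using i(2) by (simp add: sum_diff[OF finD D_Suc])
  qed (use D_Suc DS diam cov in blast)+
qed

text \<open>With all counters 0 every vertex weighs 1, so the initial total is exactly
  \<open>W ^ m\<close>.\<close>

lemma strong_sparse_cover_carving:
  fixes W :: real
  assumes W: "W \<ge> 1" "W ^ m = real (card (verts G))" and m: "m > 0"
    and L: "real L > W * ln (real (card (verts G)))" and \<rho>: "\<rho> > 0"
  shows "\<exists>\<C>. strong_sparse_cover G w (4 * real L) (real m) \<rho> \<C>"
proof -
  have "\<exists>\<C>. finite \<C> \<and>
    (\<forall>C\<in>\<C>. C \<subseteq> verts G \<and> graph_diam (G \<restriction> C) w \<le> ereal (4 * real L * \<rho>)) \<and>
    (\<forall>u\<in>verts G. graph_ball G w u \<rho> \<subseteq> verts G \<longrightarrow> (\<exists>C\<in>\<C>. graph_ball G w u \<rho> \<subseteq> C)) \<and>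
    (\<forall>x\<in>verts G. card {C \<in> \<C>. x \<in> C} + (\<lambda>_. 0) x \<le> m)"
  proof (rule carving_cover[OF W(1)])
    show "u \<in> graph_ball G w u \<rho>" if "u \<in> verts G" for u
      using that \<rho> mu_self_le by (simp add: mem_graph_ball)
    show "\<exists>I C. I \<noteq> {} \<and> I \<subseteq> C \<and> C \<subseteq> S \<and> graph_diam (G \<restriction> C) w \<le> ereal (4 * real L * \<rho>) \<and>
        (W - 1) * (\<Sum>x\<in>C - I. W ^ c x) < (\<Sum>x\<in>I. W ^ c x) \<and>
        (\<forall>u\<in>verts G. graph_ball G w u \<rho> \<subseteq> S \<longrightarrow>
          graph_ball G w u \<rho> \<subseteq> C \<or> graph_ball G w u \<rho> \<inter> I = {})"
      if "S \<subseteq> verts G" "S \<noteq> {}" "(\<Sum>x\<in>S. W ^ c x) \<le> W ^ m" for S and c :: "'v \<Rightarrow> nat"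
      using carve_ball[OF that(1,2) _ that(3) W(1) _ \<rho>, of L] W L by simp
  qed (use W m in auto)
  then obtain \<C> where "\<forall>C\<in>\<C>. C \<subseteq> verts G \<and> graph_diam (G \<restriction> C) w \<le> ereal (4 * real L * \<rho>)"
    "\<forall>u\<in>verts G. \<exists>C\<in>\<C>. graph_ball G w u \<rho> \<subseteq> C" "\<forall>x\<in>verts G. card {C \<in> \<C>. x \<in> C} \<le> m"
    using graph_ball_subset by auto
  then show ?thesis unfolding strong_sparse_cover_def by (intro exI[of _ \<C>]) auto
qed

end

section \<open>Choice of parameters\<close>

text \<open>For \<open>x = ln n\<close> and \<open>W = exp (x / m)\<close>, the left side bounds the
  number of steps \<open>L\<close>, and four times the right side is the required
  \<open>8 * k * n powr (1 / k)\<close>.\<close>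

lemma radius_bound:
  fixes x k :: real and m :: nat
  assumes x: "x \<ge> 0" and k: "k \<ge> 1" and m: "2 \<le> m" "real m \<le> 2 * k" "2 * k < real m + 1"
  shows "exp (x / m) * x + 1 \<le> 2 * k * exp (x / k)"
proof -
  \<comment> \<open>After dividing by \<open>exp (x / m)\<close>, bound \<open>exp y\<close> below by (nearly) its tangent at \<open>3 / 4\<close>.\<close>
  define y where "y = x / k - x / m"
  \<comment> \<open>From \<open>4 * k < 2 * m + 2\<close> and \<open>m \<ge> 2\<close>. Hence
    \<open>1 / m\<close> is at most \<open>3 / (4 * k)\<close>, and a quarter of the exponent
    \<open>x / k\<close> remains in \<open>y\<close>.\<close>
  have "4 * k \<le> 3 * real m" using m by linarith
  then have ky: "x / 4 \<le> k * y"
    using k m x mult_left_mono[of "4 * k" "3 * real m" x] by (simp add: y_def field_simps)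
  have "0 \<le> k * y" using ky x by simp
  then have y: "0 \<le> y" using k by (simp add: zero_le_mult_iff)
  have "(2::real) \<le> exp (3 / 4)"
    using exp_lower_Taylor_quadratic[of "3 / 4"] by (simp add: power2_eq_square)
  moreover have "1 / 4 + y \<le> exp (y - 3 / 4)"
    using exp_ge_add_one_self[of "y - 3 / 4"] by simp
  ultimately have "2 * (1 / 4 + y) \<le> exp (3 / 4) * exp (y - 3 / 4)"
    using y by (intro mult_mono) auto
  then have "2 * (1 / 4 + y) \<le> exp y"
    by (simp flip: exp_add)
  then have "2 * k * (2 * (1 / 4 + y)) \<le> 2 * k * exp y"
    using k by (intro mult_left_mono) auto
  \<comment> \<open>The right side is \<open>k + 4 * (k * y)\<close>, where \<open>k \<ge> 1\<close>
    and \<open>k * y \<ge> x / 4\<close>.\<close>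
  moreover have "1 + x \<le> 2 * k * (2 * (1 / 4 + y))"
    using ky k by (simp add: algebra_simps)
  ultimately have main: "x + 1 \<le> 2 * k * exp y" by linarith
  have "exp (x / m) * x + 1 \<le> exp (x / m) * (x + 1)"
    using x by (simp add: algebra_simps)
  also have "\<dots> \<le> exp (x / m) * (2 * k * exp y)"
    using main by (intro mult_left_mono) auto
  also have "\<dots> = 2 * k * exp (x / k)"
    by (simp add: y_def exp_diff)
  finally show ?thesis .
qed

lemma strong_sparse_cover_mono:
  assumes "strong_sparse_cover G w \<beta> s \<rho> \<C>" "\<beta> \<le> \<beta>'" "s \<le> s'" "\<rho> \<ge> 0"
  shows "strong_sparse_cover G w \<beta>' s' \<rho> \<C>"
proof -
  have "ereal (\<beta> * \<rho>) \<le> ereal (\<beta>' * \<rho>)" using assms by (simp add: mult_right_mono)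
  then show ?thesis
    using assms unfolding strong_sparse_cover_def by (meson order_trans)
qed

theorem theorem1:
  fixes G :: "('v, 'e) pre_digraph" and w :: "'e \<Rightarrow> real" and n :: nat and \<rho> k :: real
  assumes "weighted_graph G w"
    and "card (verts G) = n"
    and "\<rho> > 0"
    and "k \<ge> 1"
  shows "\<exists>\<C>. strong_sparse_cover G w (8 * k * real n powr (1 / k)) (2 * k) \<rho> \<C>"
proof -
  interpret symmetric_weighted_graph G w
    using assms(1) by (rule weighted_graph.symmetric_weighted_graph)
  show ?thesis
  proof (cases "n = 0")
    \<comment> \<open>No \<open>W \<ge> 1\<close> satisfies \<open>W ^ m = 0\<close>, so the empty
      graph is covered separately by no cluster at all.\<close>
    case True
    then have "verts G = {}" using assms(2) finite_verts by auto
    then show ?thesis by (intro exI[of _ "{}"]) (simp add: strong_sparse_cover_def)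
  next
    case False
    define m where "m = nat \<lfloor>2 * k\<rfloor>"
    have m: "2 \<le> m" "real m \<le> 2 * k" "2 * k < real m + 1"
      using assms(4) by (auto simp: m_def le_nat_iff le_floor_iff of_nat_nat)
    define x where "x = ln (real n)"
    have x: "x \<ge> 0" "exp x = real n" using False by (auto simp: x_def)
    define W where "W = exp (x / m)"
    \<comment> \<open>The least natural number strictly above \<open>W * x\<close>; rounding costs
      at most the summand 1 in \<open>radius_bound\<close>.\<close>
    define L where "L = Suc (nat \<lfloor>W * x\<rfloor>)"
    have W: "W \<ge> 1" "W ^ m = real (card (verts G))"
      using x m assms(2) by (auto simp: W_def simp flip: exp_of_nat_mult)
    have "0 \<le> W * x" using W x by simp
    then have L: "real L > W * x" "real L \<le> W * x + 1"
      unfolding L_def by linarith+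
    obtain \<C> where "strong_sparse_cover G w (4 * real L) (real m) \<rho> \<C>"
      using strong_sparse_cover_carving[OF W _ _ assms(3), of L] m L by (auto simp: assms(2) x_def)
    moreover have "4 * real L \<le> 8 * k * real n powr (1 / k)"
      using L(2) radius_bound[OF x(1) assms(4) m] False by (simp add: W_def powr_def x_def)
    ultimately show ?thesis
      using strong_sparse_cover_mono m(2) assms(3) by (metis less_imp_le)
  qed
qed

end
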